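(* Let $C^1,C^2$ be independent Cauchy processes. For all $t>0$ the following identity in distribution holds: $$C^1(|C^2(t)|)\stackrel{i.d.}{=}\frac12\,C^1(\sqrt{2t})\,C^2(\sqrt{2t}) .$$
   Context: The Cauchy process $C(t)$, $t>0$, is the process whose law at time $t$ has density $\frac{t}{\pi(t^2+x^2)}$, $x\in\mathbb{R}$ (standard symmetric Cauchy Lévy process). $X(t)\stackrel{i.d.}{=}Y(t)$ means that, for each fixed $t$, the random variables $X(t)$ and $Y(t)$ have the same law (equality of one-dimensional distributions). *)

theory Defs
  imports "HOL-Probability.Probability"
begin

text \<open>Processes are indexed by \<open>real\<close>, but only their values at times \<open>t \<ge> 0\<close> matter.\<close>

definition cadlag :: "(real \<Rightarrow> real) \<Rightarrow> bool" where
  "cadlag f \<longleftrightarrow>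
     (\<forall>t\<ge>0. (f \<longlongrightarrow> f t) (at_right t)) \<and>
     (\<forall>t>0. \<exists>l. (f \<longlongrightarrow> l) (at_left t))"

text \<open>Stochastic continuity is not listed: it follows from right-continuity of the paths
  and stationarity of the increments. All paths, not only almost all, are required to be
  cadlag, so that evaluating the process at a random time yields a random variable on an
  arbitrary (not necessarily complete) probability space.\<close>

definition levy_process :: "'a measure \<Rightarrow> (real \<Rightarrow> 'a \<Rightarrow> real) \<Rightarrow> bool" where
  "levy_process M X \<longleftrightarrow>
     prob_space M \<and>
     (\<forall>t\<ge>0. X t \<in> borel_measurable M) \<and>
     (AE \<omega> in M. X 0 \<omega> = 0) \<and>
     (\<forall>(n::nat) (t::nat \<Rightarrow> real). 0 \<le> t 0 \<and> (\<forall>i<n. t i \<le> t (Suc i)) \<longrightarrow>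
        prob_space.indep_vars M (\<lambda>_. borel) (\<lambda>i \<omega>. X (t (Suc i)) \<omega> - X (t i) \<omega>) {..<n}) \<and>
     (\<forall>s\<ge>0. \<forall>h\<ge>0. distr M borel (\<lambda>\<omega>. X (s + h) \<omega> - X s \<omega>) = distr M borel (X h)) \<and>
     (\<forall>\<omega>\<in>space M. cadlag (\<lambda>t. X t \<omega>))"

definition cauchy_process :: "'a measure \<Rightarrow> (real \<Rightarrow> 'a \<Rightarrow> real) \<Rightarrow> bool" where
  "cauchy_process M C \<longleftrightarrow>
     levy_process M C \<and>
     (\<forall>t>0. distributed M lborel (C t) (\<lambda>x. ennreal (t / (pi * (t\<^sup>2 + x\<^sup>2)))))"

text \<open>Independence of the two processes as random elements of the path space
  \<open>\<real>\<^bsup>[0,\<infinity>)\<^esup>\<close> with the product sigma-algebra.\<close>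

definition indep_processes ::
    "'a measure \<Rightarrow> (real \<Rightarrow> 'a \<Rightarrow> real) \<Rightarrow> (real \<Rightarrow> 'a \<Rightarrow> real) \<Rightarrow> bool" where
  "indep_processes M X Y \<longleftrightarrow>
     prob_space.indep_var M
       (\<Pi>\<^sub>M t\<in>{0..}. borel) (\<lambda>\<omega>. \<lambda>t\<in>{0..}. X t \<omega>)
       (\<Pi>\<^sub>M t\<in>{0..}. borel) (\<lambda>\<omega>. \<lambda>t\<in>{0..}. Y t \<omega>)"

text \<open>Measurability is part of the definition because \<open>distr\<close> is only the image measure for
  measurable functions.\<close>

definition same_law :: "'a measure \<Rightarrow> ('a \<Rightarrow> real) \<Rightarrow> ('a \<Rightarrow> real) \<Rightarrow> bool" where
  "same_law M X Y \<longleftrightarrow>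
     X \<in> borel_measurable M \<and> Y \<in> borel_measurable M \<and> distr M borel X = distr M borel Y"

end

theory Submission
  imports Defs
begin

text \<open>The law of \<open>C\<close> at time \<open>\<bar>c\<bar> s\<close> is that of \<open>c \<cdot> C s\<close>, so conditioning on the independent
  \<open>C2 t\<close> shows that \<open>C1 \<bar>C2 t\<bar>\<close> and \<open>C2 t \<cdot> C1 1\<close> have the same law; scaling both factors once more
  turns this product into the right-hand side. Path evaluation is not jointly measurable on the
  product sigma-algebra, so the conditioning is done after rounding \<open>C2 t\<close> away from zero to a
  discrete grid, where it is a countable sum, and right-continuity of the paths allows the mesh
  to tend to zero.\<close>

text \<open>Pointwise convergence carries over to characteristic functions by dominated convergence,
  because the integrand has modulus 1. The two limit laws thus share a characteristic function, and
  Levy's uniqueness theorem applies.\<close>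

lemma (in prob_space) distr_eq_LIMSEQ:
  fixes X Y :: "nat \<Rightarrow> 'a \<Rightarrow> real" and X' Y' :: "'a \<Rightarrow> real"
  assumes X [measurable]: "\<And>n. X n \<in> borel_measurable M"
    and Y [measurable]: "\<And>n. Y n \<in> borel_measurable M"
    and X' [measurable]: "X' \<in> borel_measurable M"
    and Y' [measurable]: "Y' \<in> borel_measurable M"
    and eq: "\<And>n. distr M borel (X n) = distr M borel (Y n)"
    and limX: "\<And>\<omega>. \<omega> \<in> space M \<Longrightarrow> (\<lambda>n. X n \<omega>) \<longlonglongrightarrow> X' \<omega>"
    and limY: "\<And>\<omega>. \<omega> \<in> space M \<Longrightarrow> (\<lambda>n. Y n \<omega>) \<longlonglongrightarrow> Y' \<omega>"
  shows "distr M borel X' = distr M borel Y'"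
proof -
  have char_lim: "(\<lambda>n. char (distr M borel (Z n)) u) \<longlonglongrightarrow> char (distr M borel Z') u"
    if Z [measurable]: "\<And>n. Z n \<in> borel_measurable M" "Z' \<in> borel_measurable M"
      and lim: "\<And>\<omega>. \<omega> \<in> space M \<Longrightarrow> (\<lambda>n. Z n \<omega>) \<longlonglongrightarrow> Z' \<omega>"
    for Z :: "nat \<Rightarrow> 'a \<Rightarrow> real" and Z' :: "'a \<Rightarrow> real" and u :: real
  proof -
    have "(\<lambda>n. LINT \<omega>|M. iexp (u * Z n \<omega>)) \<longlonglongrightarrow> (LINT \<omega>|M. iexp (u * Z' \<omega>))"
    proof (rule integral_dominated_convergence[where w = "\<lambda>_. 1"])
      show "AE \<omega> in M. (\<lambda>n. iexp (u * Z n \<omega>)) \<longlonglongrightarrow> iexp (u * Z' \<omega>)"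
        by (intro AE_I2 tendsto_intros lim)
    qed auto
    then show ?thesis
      by (simp add: char_def integral_distr)
  qed
  have "char (distr M borel X') u = char (distr M borel Y') u" for u
    using char_lim[OF X X' limX, of u] char_lim[OF Y Y' limY, of u]
    unfolding eq by (rule LIMSEQ_unique)
  then show ?thesis
    by (intro Levy_uniqueness real_distribution_distr X' Y') auto
qed

text \<open>This is conditioning on a discrete random index. On each event
  \<open>w (V \<omega>) = k\<close> the index is frozen and independence factors the probability, so
  only the laws of the \<open>F k\<close> enter. Each \<open>F k\<close> has to be independent of
  \<open>V\<close> separately; nothing is asked of the family jointly.\<close>

lemma (in prob_space) distr_eq_countable_mixture:
  fixes F G :: "'i::countable \<Rightarrow> 'a \<Rightarrow> 'b" and V :: "'a \<Rightarrow> 'b" and w :: "'b \<Rightarrow> 'i"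
  assumes w [measurable]: "w \<in> measurable S (count_space UNIV)"
    and F: "\<And>k. indep_var N (F k) S V"
    and G: "\<And>k. indep_var N (G k) S V"
    and eq: "\<And>k. distr M N (F k) = distr M N (G k)"
  shows "distr M N (\<lambda>\<omega>. F (w (V \<omega>)) \<omega>) = distr M N (\<lambda>\<omega>. G (w (V \<omega>)) \<omega>)"
proof -
  have meas [measurable]: "F k \<in> measurable M N" "G k \<in> measurable M N" "V \<in> measurable M S" for k
    using indep_var_rv1[OF F] indep_var_rv1[OF G] indep_var_rv2[OF F] by auto
  \<comment> \<open>Stated for a generic family \<open>H\<close> so that it serves both
    \<open>F\<close> and \<open>G\<close>; the right-hand side depends on \<open>H\<close> only
    through the marginal laws.\<close>
  have split: "emeasure M {\<omega> \<in> space M. H (w (V \<omega>)) \<omega> \<in> A} =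
      (\<integral>\<^sup>+k. emeasure (distr M N (H k)) A * emeasure M {\<omega> \<in> space M. w (V \<omega>) = k} \<partial>count_space UNIV)"
    if H: "\<And>k. indep_var N (H k) S V" and A [measurable]: "A \<in> sets N"
    for H :: "'i \<Rightarrow> 'a \<Rightarrow> 'b" and A
  proof -
    have [measurable]: "H k \<in> measurable M N" for k
      using indep_var_rv1[OF H] by auto
    have factor: "emeasure M {\<omega> \<in> space M. H k \<omega> \<in> A \<and> w (V \<omega>) = k} =
        emeasure (distr M N (H k)) A * emeasure M {\<omega> \<in> space M. w (V \<omega>) = k}" for k
    proof -
      define B where "B = w -` {k} \<inter> space S"
      have B: "B \<in> sets S"
        unfolding B_def by measurable
      have "V \<omega> \<in> space S" if "\<omega> \<in> space M" for \<omega>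
        using meas(3) that by (rule measurable_space)
      then have "{\<omega> \<in> space M. H k \<omega> \<in> A \<and> w (V \<omega>) = k} =
            (\<lambda>\<omega>. (H k \<omega>, V \<omega>)) -` (A \<times> B) \<inter> space M"
          "{\<omega> \<in> space M. w (V \<omega>) = k} = V -` B \<inter> space M"
        by (auto simp: B_def)
      then show ?thesis
        using indep_varD[OF H A B, of k]
        by (simp add: emeasure_eq_measure emeasure_distr ennreal_mult)
    qed
    have "emeasure M {\<omega> \<in> space M. H (w (V \<omega>)) \<omega> \<in> A} =
        emeasure M (\<Union>k. {\<omega> \<in> space M. H k \<omega> \<in> A \<and> w (V \<omega>) = k})"
      by (rule arg_cong[where f = "emeasure M"]) auto
    also have "\<dots> = (\<integral>\<^sup>+k. emeasure M {\<omega> \<in> space M. H k \<omega> \<in> A \<and> w (V \<omega>) = k} \<partial>count_space UNIV)"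
      by (rule emeasure_UN_countable) (auto simp: disjoint_family_on_def)
    finally show ?thesis
      by (simp only: factor)
  qed
  show ?thesis
  proof (rule measure_eqI)
    fix A assume "A \<in> sets (distr M N (\<lambda>\<omega>. F (w (V \<omega>)) \<omega>))"
    then have A [measurable]: "A \<in> sets N" by simp
    have [measurable]: "(\<lambda>\<omega>. F (w (V \<omega>)) \<omega>) \<in> measurable M N" "(\<lambda>\<omega>. G (w (V \<omega>)) \<omega>) \<in> measurable M N"
      by (rule measurable_compose_countable; measurable)+
    show "emeasure (distr M N (\<lambda>\<omega>. F (w (V \<omega>)) \<omega>)) A = emeasure (distr M N (\<lambda>\<omega>. G (w (V \<omega>)) \<omega>)) A"
      using split[of F, OF F A] split[of G, OF G A] eq
      by (simp add: emeasure_distr vimage_def Int_def conj_commute)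
  qed simp
qed

text \<open>Independence makes each joint law the product of its marginals, so equal marginals force
  equal joint laws and hence equal image laws under \<open>f\<close>.\<close>

lemma (in prob_space) indep_var_distr_cong:
  assumes XY: "indep_var S X T Y" and XY': "indep_var S X' T Y'"
    and X: "distr M S X = distr M S X'" and Y: "distr M T Y = distr M T Y'"
    and f [measurable]: "f \<in> measurable (S \<Otimes>\<^sub>M T) N"
  shows "distr M N (\<lambda>\<omega>. f (X \<omega>, Y \<omega>)) = distr M N (\<lambda>\<omega>. f (X' \<omega>, Y' \<omega>))"
proof -
  have [measurable]: "X \<in> measurable M S" "Y \<in> measurable M T"
      "X' \<in> measurable M S" "Y' \<in> measurable M T"
    using XY XY' by (auto dest: indep_var_rv1 indep_var_rv2)
  have "distr M (S \<Otimes>\<^sub>M T) (\<lambda>\<omega>. (X \<omega>, Y \<omega>)) = distr M (S \<Otimes>\<^sub>M T) (\<lambda>\<omega>. (X' \<omega>, Y' \<omega>))"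
    using XY XY' X Y by (simp add: indep_var_distribution_eq)
  then have "distr (distr M (S \<Otimes>\<^sub>M T) (\<lambda>\<omega>. (X \<omega>, Y \<omega>))) N f =
      distr (distr M (S \<Otimes>\<^sub>M T) (\<lambda>\<omega>. (X' \<omega>, Y' \<omega>))) N f"
    by simp
  then show ?thesis
    by (simp add: distr_distr comp_def)
qed

lemma indep_processes_at:
  assumes "prob_space M" "indep_processes M X Y" "0 \<le> s" "0 \<le> u"
  shows "prob_space.indep_var M borel (X s) borel (Y u)"
proof -
  interpret prob_space M by fact
  have "indep_var borel ((\<lambda>f. f s) \<circ> (\<lambda>\<omega>. \<lambda>t\<in>{0..}. X t \<omega>))
      borel ((\<lambda>f. f u) \<circ> (\<lambda>\<omega>. \<lambda>t\<in>{0..}. Y t \<omega>))"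
    using assms(3,4)
    by (intro indep_var_compose[OF assms(2)[unfolded indep_processes_def]])
      (auto intro!: measurable_component_singleton)
  then show ?thesis
    using assms(3,4) by (simp add: comp_def)
qed

text \<open>Self-similarity of index 1 of the one-dimensional laws. The sign of \<open>c\<close>
  disappears because the Cauchy density is even.\<close>

lemma cauchy_process_scale:
  assumes C: "cauchy_process M C" and "s > 0"
  shows "distr M borel (\<lambda>\<omega>. c * C s \<omega>) = distr M borel (C (\<bar>c\<bar> * s))"
proof (cases "c = 0")
  \<comment> \<open>At time 0 the law is a point mass without a density, so this case rests on
    \<open>C 0\<close> vanishing almost everywhere.\<close>
  case True
  interpret prob_space M
    using C by (simp add: cauchy_process_def levy_process_def)
  have [measurable]: "C 0 \<in> borel_measurable M" and "AE \<omega> in M. C 0 \<omega> = 0"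
    using C by (auto simp: cauchy_process_def levy_process_def)
  then have "distr M borel (C 0) = distr M borel (\<lambda>_. 0)"
    by (intro distr_cong_AE) auto
  with True show ?thesis by simp
next
  case False
  interpret prob_space M
    using C by (simp add: cauchy_process_def levy_process_def)
  have D: "distributed M lborel (C r) (\<lambda>x. ennreal (r / (pi * (r\<^sup>2 + x\<^sup>2))))" if "r > 0" for r
    using C that by (simp add: cauchy_process_def)
  \<comment> \<open>Here \<open>q\<close> stands for the sum of squares in the density, kept opaque
    so that it is not expanded; the final division by \<open>b\<close> is the Jacobian of the
    scaling.\<close>
  have cancel: "s / (pi * (q / b\<^sup>2)) / b = b * s / (pi * q)" if "b \<noteq> 0" for b q :: real
    using that by (simp add: power2_eq_square)
  have "distributed M lborel (\<lambda>\<omega>. 0 + c * C s \<omega>)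
      (\<lambda>x. ennreal (s / (pi * (s\<^sup>2 + ((x - 0) / c)\<^sup>2))) / ennreal \<bar>c\<bar>)"
    by (rule distributed_affine[OF D False]) fact
  also have "(\<lambda>x. ennreal (s / (pi * (s\<^sup>2 + ((x - 0) / c)\<^sup>2))) / ennreal \<bar>c\<bar>) =
      (\<lambda>x. ennreal (\<bar>c\<bar> * s / (pi * ((\<bar>c\<bar> * s)\<^sup>2 + x\<^sup>2))))"
  proof
    fix x :: real
    have "s\<^sup>2 + (x / c)\<^sup>2 = ((\<bar>c\<bar> * s)\<^sup>2 + x\<^sup>2) / \<bar>c\<bar>\<^sup>2"
      using False by (simp add: field_simps power_mult_distrib)
    then have "s / (pi * (s\<^sup>2 + ((x - 0) / c)\<^sup>2)) / \<bar>c\<bar> = \<bar>c\<bar> * s / (pi * ((\<bar>c\<bar> * s)\<^sup>2 + x\<^sup>2))"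
      using cancel[of "\<bar>c\<bar>"] False by simp
    moreover have "0 \<le> s / (pi * (s\<^sup>2 + ((x - 0) / c)\<^sup>2))"
      using \<open>s > 0\<close> by simp
    ultimately show "ennreal (s / (pi * (s\<^sup>2 + ((x - 0) / c)\<^sup>2))) / ennreal \<bar>c\<bar> =
        ennreal (\<bar>c\<bar> * s / (pi * ((\<bar>c\<bar> * s)\<^sup>2 + x\<^sup>2)))"
      using False by (simp add: divide_ennreal)
  qed
  finally have "distr M lborel (\<lambda>\<omega>. 0 + c * C s \<omega>) = distr M lborel (C (\<bar>c\<bar> * s))"
    using D[of "\<bar>c\<bar> * s"] False \<open>s > 0\<close>
    by (simp add: distributed_def)
  \<comment> \<open>Only the sigma-algebra of the target enters an image measure, and
    \<open>lborel\<close> and \<open>borel\<close> share it.\<close>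
  moreover have "distr M lborel Z = distr M borel Z" for Z :: "'a \<Rightarrow> real"
    by (rule distr_cong) auto
  ultimately show ?thesis by simp
qed

text \<open>Right-continuity controls approach from the right only, whence the condition
  \<open>ge\<close>. Passing from \<open>at_right x\<close> to \<open>{x..}\<close> allows the
  sequence to hit \<open>x\<close> itself.\<close>

lemma cadlag_LIMSEQ_from_above:
  assumes f: "cadlag f" and "x \<ge> 0" and s: "s \<longlonglongrightarrow> x" and ge: "\<And>n. x \<le> s n"
  shows "(\<lambda>n. f (s n)) \<longlonglongrightarrow> f x"
proof -
  have "continuous (at_right x) f"
    using f \<open>x \<ge> 0\<close> by (simp add: cadlag_def continuous_within)
  then have "continuous (at x within {x..}) f"
    by (simp add: continuous_within at_within_Ici_at_right)
  with s ge show ?thesis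
    unfolding continuous_within_sequentially by (auto simp: comp_def)
qed

text \<open>The numerator of a grid point of mesh \<open>1 / Suc n\<close>. Rounding away from zero
  makes the absolute values approach from above, as right-continuity demands, while the sign is kept
  so that the grid points converge to \<open>y\<close> itself.\<close>

definition round_away :: "nat \<Rightarrow> real \<Rightarrow> int" where
  "round_away n y = (if y \<ge> 0 then \<lceil>real (Suc n) * y\<rceil> else \<lfloor>real (Suc n) * y\<rfloor>)"

lemma round_away_measurable [measurable]:
  "round_away n \<in> measurable borel (count_space UNIV)"
  unfolding round_away_def by measurable

lemma round_away_ge: "\<bar>y\<bar> \<le> \<bar>round_away n y\<bar> / Suc n"
proof -
  have "\<bar>real (Suc n) * y\<bar> \<le> \<bar>real_of_int (round_away n y)\<bar>"
  proof (cases "y \<ge> 0")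
    case True
    then have "0 \<le> real (Suc n) * y" by simp
    with True show ?thesis
      unfolding round_away_def by (simp only: if_True) linarith
  next
    case False
    then have "real (Suc n) * y < 0" by (simp only: mult_less_0_iff) auto
    with False show ?thesis
      unfolding round_away_def by (simp only: if_False) linarith
  qed
  then show ?thesis
    by (simp only: abs_mult) (simp add: pos_le_divide_eq mult.commute)
qed

lemma round_away_LIMSEQ: "(\<lambda>n. round_away n y / Suc n) \<longlonglongrightarrow> y"
proof -
  have "\<bar>round_away n y / Suc n - y\<bar> \<le> 1 / Suc n" for n
  proof -
    have "\<bar>round_away n y - real (Suc n) * y\<bar> \<le> 1"
      unfolding round_away_def by (simp split: if_splits; linarith)
    moreover have "round_away n y / Suc n - y = (round_away n y - real (Suc n) * y) / Suc n"
      by (simp add: field_simps)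
    ultimately show ?thesis
      by (simp only: abs_divide) (simp add: divide_right_mono)
  qed
  then have "(\<lambda>n. round_away n y / Suc n - y) \<longlonglongrightarrow> 0"
    by (intro Lim_null_comparison[OF _ LIMSEQ_inverse_real_of_nat]) (auto simp: inverse_eq_divide)
  then show ?thesis by (simp add: LIM_zero_iff)
qed

theorem theorem4p2:
  fixes M :: "'a measure" and C1 C2 :: "real \<Rightarrow> 'a \<Rightarrow> real" and t :: real
  assumes "cauchy_process M C1" and "cauchy_process M C2"
    and "indep_processes M C1 C2"
    and "t > 0"
  shows "same_law M
           (\<lambda>\<omega>. C1 \<bar>C2 t \<omega>\<bar> \<omega>)
           (\<lambda>\<omega>. 1/2 * C1 (sqrt (2 * t)) \<omega> * C2 (sqrt (2 * t)) \<omega>)"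
proof -
  interpret prob_space M
    using assms(1) by (simp add: cauchy_process_def levy_process_def)
  have meas [measurable]: "C1 s \<in> borel_measurable M" "C2 s \<in> borel_measurable M" if "s \<ge> 0" for s
    using assms(1,2) that by (auto simp: cauchy_process_def levy_process_def)
  have cad: "cadlag (\<lambda>s. C1 s \<omega>)" if "\<omega> \<in> space M" for \<omega>
    using assms(1) that by (auto simp: cauchy_process_def levy_process_def)
  have ind: "indep_var borel (C1 s) borel (C2 u)" if "s \<ge> 0" "u \<ge> 0" for s u
    using indep_processes_at[OF prob_space_axioms assms(3)] that by simp
  define W where "W n \<omega> = round_away n (C2 t \<omega>)" for n \<omega>
  \<comment> \<open>\<open>F\<close> evaluates the process at a deterministic grid time, and
    \<open>G\<close> is its counterpart with the same law obtained by scaling \<open>C1 1\<close>.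
    \<open>G\<close> retains the sign of \<open>k\<close>, so that its limit is the product with
    \<open>C2 t\<close> rather than with its absolute value.\<close>
  define F where "F n k = C1 (\<bar>real_of_int k\<bar> / Suc n)" for n k
  define G where "G n k \<omega> = real_of_int k / Suc n * C1 1 \<omega>" for n k \<omega>
  have C2t [measurable]: "C2 t \<in> borel_measurable M"
    using assms(4) by (intro meas) simp
  have W [measurable]: "W n \<in> measurable M (count_space UNIV)" for n
    unfolding W_def by measurable
  have [measurable]: "F n k \<in> borel_measurable M" for n k
    unfolding F_def by (intro meas) simp
  have [measurable]: "C1 1 \<in> borel_measurable M" by (intro meas) simp
  have [measurable]: "G n k \<in> borel_measurable M" for n k
    unfolding G_def by measurable
  have FW [measurable]: "(\<lambda>\<omega>. F n (W n \<omega>) \<omega>) \<in> borel_measurable M" for n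
    by (rule measurable_compose_countable) measurable
  have GW [measurable]: "(\<lambda>\<omega>. G n (W n \<omega>) \<omega>) \<in> borel_measurable M" for n
    by (rule measurable_compose_countable) measurable
  have eq: "distr M borel (\<lambda>\<omega>. F n (W n \<omega>) \<omega>) = distr M borel (\<lambda>\<omega>. G n (W n \<omega>) \<omega>)" for n
    unfolding W_def
  proof (rule distr_eq_countable_mixture[OF round_away_measurable])
    fix k
    show "indep_var borel (F n k) borel (C2 t)"
      using assms(4) unfolding F_def by (intro ind) auto
    have "indep_var borel ((\<lambda>x. real_of_int k / Suc n * x) \<circ> C1 1) borel ((\<lambda>x. x) \<circ> C2 t)"
      using assms(4) by (intro indep_var_compose[OF ind]) auto
    then show "indep_var borel (G n k) borel (C2 t)"
      by (simp add: G_def[abs_def] comp_def)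
    show "distr M borel (F n k) = distr M borel (G n k)"
      using cauchy_process_scale[OF assms(1), of 1 "real_of_int k / Suc n"]
      by (simp add: F_def G_def[abs_def])
  qed
  have limF: "(\<lambda>n. F n (W n \<omega>) \<omega>) \<longlonglongrightarrow> C1 \<bar>C2 t \<omega>\<bar> \<omega>" if "\<omega> \<in> space M" for \<omega>
    unfolding F_def W_def
  proof (rule cadlag_LIMSEQ_from_above[OF cad[OF that]])
    show "(\<lambda>n. \<bar>real_of_int (round_away n (C2 t \<omega>))\<bar> / Suc n) \<longlonglongrightarrow> \<bar>C2 t \<omega>\<bar>"
      using tendsto_rabs[OF round_away_LIMSEQ[of "C2 t \<omega>"]] by simp
    show "\<bar>C2 t \<omega>\<bar> \<le> \<bar>real_of_int (round_away n (C2 t \<omega>))\<bar> / Suc n" for n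
      using round_away_ge[of "C2 t \<omega>" n] by simp
  qed simp
  have limG: "(\<lambda>n. G n (W n \<omega>) \<omega>) \<longlonglongrightarrow> C2 t \<omega> * C1 1 \<omega>" for \<omega>
    unfolding G_def W_def by (intro tendsto_intros round_away_LIMSEQ)
  \<comment> \<open>Measurability at the random time is inherited from the discretized versions,
    which converge at every point of the space.\<close>
  have L [measurable]: "(\<lambda>\<omega>. C1 \<bar>C2 t \<omega>\<bar> \<omega>) \<in> borel_measurable M"
    by (rule borel_measurable_LIMSEQ_real[OF limF]) auto
  have main: "distr M borel (\<lambda>\<omega>. C1 \<bar>C2 t \<omega>\<bar> \<omega>) = distr M borel (\<lambda>\<omega>. C2 t \<omega> * C1 1 \<omega>)"
    by (rule distr_eq_LIMSEQ[OF FW GW L _ eq limF limG]) auto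
  define a where "a = sqrt (2 * t)"
  have a: "a > 0" "a * a = 2 * t"
    using assms(4) by (auto simp: a_def)
  \<comment> \<open>By scaling, \<open>C1 a\<close> has the law of \<open>a * C1 1\<close> and
    \<open>C2 a\<close> that of \<open>a / t * C2 t\<close>. With the prefactor 1/2 the constants
    multiply to \<open>a * a / (2 * t)\<close>, which is 1.\<close>
  have ind': "indep_var borel ((\<lambda>x. a * x) \<circ> C1 1) borel ((\<lambda>x. a / t * x) \<circ> C2 t)"
    using assms(4) by (intro indep_var_compose[OF ind]) auto
  have [measurable]: "C1 a \<in> borel_measurable M" "C2 a \<in> borel_measurable M"
    using a by (auto intro: meas)
  have "distr M borel (\<lambda>\<omega>. (\<lambda>(x, y). 1/2 * x * y) (C1 a \<omega>, C2 a \<omega>)) =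
      distr M borel (\<lambda>\<omega>. (\<lambda>(x, y). 1/2 * x * y) (((\<lambda>x. a * x) \<circ> C1 1) \<omega>, ((\<lambda>x. a / t * x) \<circ> C2 t) \<omega>))"
  proof (rule indep_var_distr_cong[OF ind ind'])
    show "distr M borel (C1 a) = distr M borel ((\<lambda>x. a * x) \<circ> C1 1)"
      using cauchy_process_scale[OF assms(1), of 1 a] a by (simp add: comp_def)
    show "distr M borel (C2 a) = distr M borel ((\<lambda>x. a / t * x) \<circ> C2 t)"
      using cauchy_process_scale[OF assms(2), of t "a / t"] a assms(4) by (simp add: comp_def)
  qed (use a in auto)
  also have "(\<lambda>\<omega>. (\<lambda>(x, y). 1/2 * x * y) (((\<lambda>x. a * x) \<circ> C1 1) \<omega>, ((\<lambda>x. a / t * x) \<circ> C2 t) \<omega>)) =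
      (\<lambda>\<omega>. C2 t \<omega> * C1 1 \<omega>)"
  proof
    fix \<omega>
    have "1/2 * (a * C1 1 \<omega>) * (a / t * C2 t \<omega>) = (a * a) / (2 * t) * (C2 t \<omega> * C1 1 \<omega>)"
      by simp
    then show "(\<lambda>(x, y). 1/2 * x * y) (((\<lambda>x. a * x) \<circ> C1 1) \<omega>, ((\<lambda>x. a / t * x) \<circ> C2 t) \<omega>) =
        C2 t \<omega> * C1 1 \<omega>"
      using assms(4) unfolding a(2) by simp
  qed
  finally show ?thesis
    unfolding same_law_def a_def[symmetric] using main by auto
qed

end
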